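(* Let $s\in[0,1]$, and let $s=0.a_1a_2\ldots$ be a (lower or upper) binary expansion of $s$. Let $$d_{\sup}(s) := \limsup_{n\to\infty}\frac1n\sum_{i=1}^n|a_i-a_{i+1}|.$$ If $d_{\sup}(s) < 1 - \frac{\ln \frac{3}{5}}{\ln \frac{1}{2}}$ $(\approx 0.263)$, then $u'(s) = \infty$.
   Context: Let $M_0 = \frac{1}{5}\begin{pmatrix} 5 & 2 & 2\\ 0 & 2 & 1\\ 0 & 1 & 2 \end{pmatrix}$ and $M_1 = \frac{1}{5}\begin{pmatrix} 2 & 0 & 1\\ 2 & 5 & 2\\ 1 & 0 & 2 \end{pmatrix}$, and let $h_0(x) = \frac{x}{2}$, $h_1(x) = \frac{x+1}{2}$. Let $u:[0,1]\to\mathbb{R}^3$ be the unique continuous function satisfying $u(0) = (1,0,0)^T$, $u(1) = (0,1,0)^T$, $u\circ h_0 = M_0\circ u$ and $u \circ h_1 = M_1\circ u$ on $[0,1]$ (this function is known to exist and to be unique). The notation $u'(s)=\infty$ means $\lim_{t\to s,\ t\in[0,1],\ t\ne s}\frac{\|u(t)-u(s)\|}{|t-s|} = \infty$, for any norm on $\mathbb{R}^3$. For $s\in[0,1)$ (resp. $s\in(0,1]$), the upper (resp. lower) binary expansion of $s$ is the unique sequence $(a_i)_{i\ge1}$ in $\{0,1\}$ with $s = \sum_{i\ge1} a_i2^{-i}$ that does not end with an infinite sequence of $1$'s (resp. of $0$'s). *)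

theory Defs
  imports "HOL-Analysis.Analysis"
begin

definition M0 :: "real^3^3" where
  "M0 = (1/5) *\<^sub>R vector [vector [5, 2, 2], vector [0, 2, 1], vector [0, 1, 2]]"

definition M1 :: "real^3^3" where
  "M1 = (1/5) *\<^sub>R vector [vector [2, 0, 1], vector [2, 5, 2], vector [1, 0, 2]]"

definition h0 :: "real \<Rightarrow> real" where
  "h0 x = x / 2"

definition h1 :: "real \<Rightarrow> real" where
  "h1 x = (x + 1) / 2"

text \<open>
  The curve is a function on the unit interval; values outside of the interval are unconstrained.
  Exactly one function on the interval satisfies this predicate.
\<close>
definition gasket_curve :: "(real \<Rightarrow> real^3) \<Rightarrow> bool" where
  "gasket_curve u \<longleftrightarrow>
     continuous_on {0..1} u \<and>
     u 0 = vector [1, 0, 0] \<and>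
     u 1 = vector [0, 1, 0] \<and>
     (\<forall>x\<in>{0..1}. u (h0 x) = M0 *v u x) \<and>
     (\<forall>x\<in>{0..1}. u (h1 x) = M1 *v u x)"

definition is_norm :: "('a::real_vector \<Rightarrow> real) \<Rightarrow> bool" where
  "is_norm N \<longleftrightarrow>
     (\<forall>x. 0 \<le> N x) \<and>
     (\<forall>x. N x = 0 \<longleftrightarrow> x = 0) \<and>
     (\<forall>x y. N (x + y) \<le> N x + N y) \<and>
     (\<forall>c x. N (c *\<^sub>R x) = \<bar>c\<bar> * N x)"

text \<open>
  The limit is one-sided at the endpoints of the unit interval. All norms on a
  finite-dimensional space being equivalent, quantifying over them does not change the notion.
\<close>
definition infinite_derivative :: "(real \<Rightarrow> real^3) \<Rightarrow> real \<Rightarrow> bool" where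
  "infinite_derivative u s \<longleftrightarrow>
     (\<forall>N. is_norm N \<longrightarrow>
        filterlim (\<lambda>t. N (u t - u s) / \<bar>t - s\<bar>) at_top (at s within {0..1}))"

text \<open>
  Digit sequences are indexed from 1; the value at index 0 is irrelevant throughout.
\<close>
definition binary_digits_of :: "(nat \<Rightarrow> int) \<Rightarrow> real \<Rightarrow> bool" where
  "binary_digits_of a s \<longleftrightarrow>
     (\<forall>i\<ge>1. a i \<in> {0, 1}) \<and>
     (\<lambda>i. real_of_int (a (Suc i)) / 2 ^ Suc i) sums s"

definition upper_binary_expansion :: "(nat \<Rightarrow> int) \<Rightarrow> real \<Rightarrow> bool" where
  "upper_binary_expansion a s \<longleftrightarrow>
     s \<in> {0..<1} \<and> binary_digits_of a s \<and> \<not> (\<exists>m. \<forall>i\<ge>m. a i = 1)"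

definition lower_binary_expansion :: "(nat \<Rightarrow> int) \<Rightarrow> real \<Rightarrow> bool" where
  "lower_binary_expansion a s \<longleftrightarrow>
     s \<in> {0<..1} \<and> binary_digits_of a s \<and> \<not> (\<exists>m. \<forall>i\<ge>m. a i = 0)"

text \<open>
  Stated for the digit sequence rather than for the number it represents. The two expansions of
  a dyadic rational are both eventually constant, so both give 0. The junk term for
  \<open>n = 0\<close> does not affect the limit superior.
\<close>
definition d_sup :: "(nat \<Rightarrow> int) \<Rightarrow> ereal" where
  "d_sup a =
     limsup (\<lambda>n. ereal ((1 / real n) * (\<Sum>i=1..n. real_of_int \<bar>a i - a (i + 1)\<bar>)))"

end

theory Submission
  imports Defs
begin

text \<open>
  The curve lies in the plane \<open>x + y + z = 1\<close>, so it is described by the two real functions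
  \<open>P = y\<close> and \<open>Q = 1 - x\<close>. In these coordinates the linear parts of the two
  self-similarities become the nonnegative matrices
  \<open>(p, q) \<mapsto> ((p + q)/5, 3q/5)\<close> for the digit 0 and \<open>(p, q) \<mapsto> (3p/5, (p + q)/5)\<close>
  for the digit 1. Both map the cone \<open>q/2 \<le> p \<le> 2q\<close> into itself, and the increment
  \<open>(1, 1)\<close> of \<open>(P, Q)\<close> over the unit interval lies in it. Hence the increments over all
  dyadic cells lie in the cone (\<open>increment_in_cone\<close>), and \<open>P\<close> and \<open>Q\<close> are increasing
  (\<open>mono_coordinates\<close>).

  Consider the cell of level \<open>m\<close> selected by the first \<open>m\<close> digits of \<open>s\<close>. The digit 0
  multiplies \<open>q\<close> by exactly \<open>3/5\<close>, the digit 1 multiplies \<open>p\<close> by exactly \<open>3/5\<close>. Following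
  \<open>q\<close> along zeros and \<open>p\<close> along ones, one loses a factor of at most 2 at each change of
  digit, by the cone condition. With \<open>D\<close> digit changes, the increment over the cell is
  therefore at least \<open>(3/5)^m 2^(-D)\<close> (\<open>digit_cell_increment\<close>).

  If \<open>\<bar>t - s\<bar>\<close> is between \<open>2\<close> and \<open>4\<close> times \<open>2^(-m)\<close>, a neighbour of this cell lies between
  \<open>s\<close> and \<open>t\<close>. Neighbouring increments are comparable up to a factor 2, even when the digits of
  the two cells differ widely (\<open>neighbouring_increments_comparable\<close>). By monotonicity,
  \<open>\<parallel>u t - u s\<parallel>\<close> is then at least a constant times \<open>(3/5)^m 2^(-D)\<close>
  (\<open>coordinate_separation\<close>), so the difference quotient is at least a constant times
  \<open>(6/5)^m 2^(-D)\<close>. The threshold on the density of digit changes is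
  \<open>log 2 (6/5)\<close>, which is what makes this quantity tend to infinity
  (\<open>growth_of_few_digit_changes\<close>).
\<close>

section \<open>The two monotone coordinates of the curve\<close>

text \<open>
  The self-similarity of the curve in the coordinates \<open>P = y\<close> and \<open>Q = 1 - x\<close>, with
  \<open>z = Q - P\<close> eliminated. They are chosen so that both increase and all coefficients are
  nonnegative. Reversing the parameter and exchanging the two endpoints of the curve exchanges
  the increments of \<open>P\<close> and \<open>Q\<close>.
\<close>
locale gasket_coordinates =
  fixes P Q :: "real \<Rightarrow> real"
  assumes P_0: "P 0 = 0" and Q_0: "Q 0 = 0" and P_1: "P 1 = 1" and Q_1: "Q 1 = 1"
    and P_left: "x \<in> {0..1} \<Longrightarrow> P (x / 2) = (P x + Q x) / 5"
    and Q_left: "x \<in> {0..1} \<Longrightarrow> Q (x / 2) = 3 / 5 * Q x"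
    and P_right: "x \<in> {0..1} \<Longrightarrow> P ((x + 1) / 2) = (2 + 3 * P x) / 5"
    and Q_right: "x \<in> {0..1} \<Longrightarrow> Q ((x + 1) / 2) = (3 + P x + Q x) / 5"
    and P_cont: "continuous_on {0..1} P" and Q_cont: "continuous_on {0..1} Q"

text \<open>
  The columns of both matrices sum to 1, so the sum of the coordinates takes the same value at
  \<open>x\<close> and at \<open>x/2\<close>, hence at every \<open>x/2^n\<close>; by continuity this is its value at 0.
\<close>
lemma gasket_curve_sum_eq_1:
  assumes u: "gasket_curve u" and x: "x \<in> {0..1}"
  shows "u x $ 1 + u x $ 2 + u x $ 3 = 1"
proof -
  define S where "S y = u y $ 1 + u y $ 2 + u y $ 3" for y
  have half: "S (y / 2) = S y" if "y \<in> {0..1}" for y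
  proof -
    have "u (y / 2) = M0 *v u y"
      using u that unfolding gasket_curve_def h0_def by blast
    then show ?thesis
      by (simp add: S_def M0_def matrix_vector_mult_def sum_3)
  qed
  have in_unit: "x / 2 ^ n \<in> {0..1}" for n
  proof -
    have "x \<le> 1" using x by simp
    also have "(1::real) \<le> 2 ^ n" by (rule one_le_power) simp
    finally show ?thesis using x by simp
  qed
  have const: "S (x / 2 ^ n) = S x" for n
  proof (induction n)
    case (Suc n)
    have "S (x / 2 ^ Suc n) = S (x / 2 ^ n / 2)" by (simp add: field_simps)
    then show ?case using half[OF in_unit[of n]] Suc by simp
  qed simp
  have "continuous_on {0..1} S"
    unfolding S_def using u unfolding gasket_curve_def by (intro continuous_intros) auto
  moreover have "(\<lambda>n. x / 2 ^ n) \<longlonglongrightarrow> 0"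
    by (intro LIMSEQ_divide_realpow_zero) auto
  ultimately have "(\<lambda>n. S (x / 2 ^ n)) \<longlonglongrightarrow> S 0"
    by (rule continuous_on_tendsto_compose) (use in_unit in auto)
  then have "S x = S 0" by (simp add: const LIMSEQ_const_iff)
  moreover have "S 0 = 1"
    using u by (simp add: S_def gasket_curve_def)
  ultimately show ?thesis by (simp add: S_def)
qed

lemma gasket_coordinates_of_curve:
  assumes u: "gasket_curve u"
  shows "gasket_coordinates (\<lambda>x. u x $ 2) (\<lambda>x. 1 - u x $ 1)"
proof -
  have sum1: "u x $ 3 = 1 - u x $ 1 - u x $ 2" if "x \<in> {0..1}" for x
    using gasket_curve_sum_eq_1[OF u that] by simp
  have L: "u (x / 2) = M0 *v u x" and R: "u ((x + 1) / 2) = M1 *v u x" if "x \<in> {0..1}" for x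
    using u that unfolding gasket_curve_def h0_def h1_def by blast+
  have cont: "continuous_on {0..1} u" and u0: "u 0 = vector [1, 0, 0]" and u1: "u 1 = vector [0, 1, 0]"
    using u unfolding gasket_curve_def by blast+
  show ?thesis
  proof
    show "continuous_on {0..1} (\<lambda>x. u x $ 2)" "continuous_on {0..1} (\<lambda>x. 1 - u x $ 1)"
      by (intro continuous_intros cont)+
  qed (simp_all add: u0 u1 L R sum1 M0_def M1_def matrix_vector_mult_def sum_3 field_simps)
qed

section \<open>Increments over dyadic cells\<close>

definition cell_increment :: "(real \<Rightarrow> real) \<Rightarrow> nat \<Rightarrow> nat \<Rightarrow> real" where
  "cell_increment f m k = f ((real k + 1) / 2 ^ m) - f (real k / 2 ^ m)"

lemma dyadic_in_unit: "k \<le> 2 ^ m \<Longrightarrow> real k / 2 ^ m \<in> {0..1}"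
  using of_nat_le_iff[of k "2 ^ m", where 'a = real] by simp

context gasket_coordinates
begin

abbreviation "dP \<equiv> cell_increment P"
abbreviation "dQ \<equiv> cell_increment Q"

lemma increment_left:
  assumes "k < 2 ^ m"
  shows "dP (Suc m) k = (dP m k + dQ m k) / 5" "dQ (Suc m) k = 3 / 5 * dQ m k"
proof -
  have lo: "real k / 2 ^ m \<in> {0..1}" and hi: "(real k + 1) / 2 ^ m \<in> {0..1}"
    using dyadic_in_unit[of k m] dyadic_in_unit[of "Suc k" m] assms by (simp_all add: add.commute)
  have eq: "y / 2 ^ Suc m = y / 2 ^ m / 2" for y :: real by simp
  show "dP (Suc m) k = (dP m k + dQ m k) / 5" "dQ (Suc m) k = 3 / 5 * dQ m k"
    unfolding cell_increment_def eq P_left[OF lo] P_left[OF hi] Q_left[OF lo] Q_left[OF hi]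
    by (simp_all add: field_simps)
qed

lemma increment_right:
  assumes "k < 2 ^ m"
  shows "dP (Suc m) (2 ^ m + k) = 3 / 5 * dP m k" "dQ (Suc m) (2 ^ m + k) = (dP m k + dQ m k) / 5"
proof -
  have lo: "real k / 2 ^ m \<in> {0..1}" and hi: "(real k + 1) / 2 ^ m \<in> {0..1}"
    using dyadic_in_unit[of k m] dyadic_in_unit[of "Suc k" m] assms by (simp_all add: add.commute)
  have eq: "real (2 ^ m + k) / 2 ^ Suc m = (real k / 2 ^ m + 1) / 2"
    "(real (2 ^ m + k) + 1) / 2 ^ Suc m = ((real k + 1) / 2 ^ m + 1) / 2"
    by (simp_all add: field_simps)
  show "dP (Suc m) (2 ^ m + k) = 3 / 5 * dP m k" "dQ (Suc m) (2 ^ m + k) = (dP m k + dQ m k) / 5"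
    unfolding cell_increment_def eq P_right[OF lo] P_right[OF hi] Q_right[OF lo] Q_right[OF hi]
    by (simp_all add: field_simps)
qed

text \<open>
  On the ratio \<open>r = p/q\<close> the digit 0 acts as \<open>r \<mapsto> (r + 1)/3\<close>, the digit 1 acts likewise on
  \<open>1/r\<close>. The interval \<open>[1/2, 2]\<close> is invariant under both; \<open>1/2\<close> and \<open>2\<close> are the fixed points.
\<close>
lemma increment_in_cone:
  "k < 2 ^ m \<Longrightarrow> 0 < dP m k \<and> 0 < dQ m k \<and> dP m k \<le> 2 * dQ m k \<and> dQ m k \<le> 2 * dP m k"
proof (induction m arbitrary: k)
  case 0
  then show ?case by (simp add: cell_increment_def P_0 P_1 Q_0 Q_1)
next
  case (Suc m)
  show ?case
  proof (cases "k < 2 ^ m")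
    case True
    show ?thesis using Suc.IH[OF True] by (simp add: increment_left[OF True])
  next
    case False
    define j where "j = k - 2 ^ m"
    have k: "k = 2 ^ m + j" and j: "j < 2 ^ m" using False Suc.prems by (auto simp: j_def)
    show ?thesis using Suc.IH[OF j] unfolding k by (simp add: increment_right[OF j])
  qed
qed

text \<open>
  The first and the last cell are exchanged by the reflection symmetry of the curve. The lemma
  serves to compare the two cells that meet at the midpoint of an interval, whose digits
  \<open>01...1\<close> and \<open>10...0\<close> have no position in common.
\<close>
lemma outermost_increments_mirror:
  "dP m (2 ^ m - 1) = dQ m 0 \<and> dQ m (2 ^ m - 1) = dP m 0 \<and> dP m 0 \<le> dQ m 0"
proof (induction m)
  case 0
  then show ?case by (simp add: cell_increment_def P_0 P_1 Q_0 Q_1)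
next
  case (Suc m)
  have k: "2 ^ Suc m - 1 = 2 ^ m + (2 ^ m - (1::nat))" by simp
  have lt: "(0::nat) < 2 ^ m" "2 ^ m - 1 < (2::nat) ^ m" by simp_all
  show ?case
    unfolding k increment_left[OF lt(1)] increment_right[OF lt(2)]
    using Suc increment_in_cone[OF lt(1)] by auto
qed

text \<open>
  Positivity of the maps propagates a componentwise comparison of two increments to all their
  images, so only two cells meeting at \<open>1/2\<close> need an argument. If the first cell of
  level \<open>m\<close> has increment \<open>(p, q)\<close>, the last one has \<open>(q, p)\<close>, and the two cells at
  \<open>1/2\<close> have the increments \<open>((p + q)/5, 3p/5)\<close> and \<open>(3p/5, (p + q)/5)\<close>, where
  \<open>p \<le> q \<le> 2p\<close>.
\<close>
lemma neighbouring_increments_comparable: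
  "Suc k < 2 ^ m \<Longrightarrow>
    dP m k \<le> 2 * dP m (Suc k) \<and> dP m (Suc k) \<le> 2 * dP m k \<and>
    dQ m k \<le> 2 * dQ m (Suc k) \<and> dQ m (Suc k) \<le> 2 * dQ m k"
proof (induction m arbitrary: k)
  case (Suc m)
  consider (left) "Suc k < 2 ^ m" | (middle) "Suc k = 2 ^ m" | (right) "2 ^ m \<le> k" by linarith
  then show ?case
  proof cases
    case left
    then have "k < 2 ^ m" by simp
    show ?thesis
      unfolding increment_left[OF left] increment_left[OF \<open>k < 2 ^ m\<close>]
      using Suc.IH[OF left] by auto
  next
    case middle
    then have k: "k = 2 ^ m - 1" and lt: "k < 2 ^ m" and lt0: "(0::nat) < 2 ^ m" by simp_all
    have Sk: "Suc k = 2 ^ m + 0" using middle by simp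
    show ?thesis
      unfolding Sk increment_left[OF lt] increment_right[OF lt0]
      using outermost_increments_mirror[of m] increment_in_cone[OF lt0] unfolding k by auto
  next
    case right
    define j where "j = k - 2 ^ m"
    have j: "Suc j < 2 ^ m" "j < 2 ^ m" and k: "k = 2 ^ m + j"
      using right Suc.prems by (auto simp: j_def)
    have Sk: "Suc k = 2 ^ m + Suc j" using k by simp
    show ?thesis
      unfolding Sk unfolding k increment_right[OF j(1)] increment_right[OF j(2)]
      using Suc.IH[OF j(1)] by auto
  qed
qed simp

lemma mono_on_dyadics:
  assumes "i \<le> j" "j \<le> 2 ^ m"
  shows "P (real i / 2 ^ m) \<le> P (real j / 2 ^ m) \<and> Q (real i / 2 ^ m) \<le> Q (real j / 2 ^ m)"
  using assms
proof (induction j rule: dec_induct)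
  case (step j)
  then show ?case
    using increment_in_cone[of j m] by (auto simp: cell_increment_def add.commute)
qed simp

text \<open>
  Monotonicity passes from the dyadic rationals to the whole interval by continuity, rounding
  both arguments down to multiples of \<open>2^(-m)\<close>.
\<close>
lemma mono_coordinates:
  assumes "0 \<le> s" "s \<le> t" "t \<le> 1"
  shows "P s \<le> P t \<and> Q s \<le> Q t"
proof -
  define r where "r x m = nat \<lfloor>x * 2 ^ m\<rfloor>" for x :: real and m :: nat
  have r_le: "r x m \<le> 2 ^ m" if "x \<in> {0..1}" for x m
  proof -
    have "x * 2 ^ m \<le> 2 ^ m" using that by simp
    then have "\<lfloor>x * 2 ^ m\<rfloor> \<le> \<lfloor>(2::real) ^ m\<rfloor>" by (rule floor_mono)
    also have "\<lfloor>(2::real) ^ m\<rfloor> = 2 ^ m" by (metis floor_of_int of_int_numeral of_int_power)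
    finally show ?thesis by (simp add: r_def nat_le_iff)
  qed
  have lim: "(\<lambda>m. real (r x m) / 2 ^ m) \<longlonglongrightarrow> x" if "x \<in> {0..1}" for x
  proof (rule real_tendsto_sandwich)
    have "x * 2 ^ m - 1 \<le> real (r x m) \<and> real (r x m) \<le> x * 2 ^ m" for m
      using that by (simp add: r_def)
    then have bnd: "x - 1 / 2 ^ m \<le> real (r x m) / 2 ^ m \<and> real (r x m) / 2 ^ m \<le> x" for m
      by (simp add: pos_le_divide_eq pos_divide_le_eq left_diff_distrib)
    show "\<forall>\<^sub>F m in sequentially. x - 1 / 2 ^ m \<le> real (r x m) / 2 ^ m"
      using bnd by simp
    show "\<forall>\<^sub>F m in sequentially. real (r x m) / 2 ^ m \<le> x"
      using bnd by simp
    have "(\<lambda>m. 1 / 2 ^ m :: real) \<longlonglongrightarrow> 0" by (intro LIMSEQ_divide_realpow_zero) auto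
    from tendsto_diff[OF tendsto_const[of x] this]
    show "(\<lambda>m. x - 1 / 2 ^ m) \<longlonglongrightarrow> x" by simp
  qed simp
  have lim_of: "(\<lambda>m. f (real (r x m) / 2 ^ m)) \<longlonglongrightarrow> f x"
    if "continuous_on {0..1} f" "x \<in> {0..1}" for f :: "real \<Rightarrow> real" and x
    using that(1) lim[OF that(2)] that(2)
    by (rule continuous_on_tendsto_compose) (use dyadic_in_unit r_le that in auto)
  have s: "s \<in> {0..1}" and t: "t \<in> {0..1}" using assms by auto
  have "r s m \<le> r t m" for m
    using assms by (auto simp: r_def intro!: nat_mono floor_mono mult_right_mono)
  then have "P (real (r s m) / 2 ^ m) \<le> P (real (r t m) / 2 ^ m)"
    and "Q (real (r s m) / 2 ^ m) \<le> Q (real (r t m) / 2 ^ m)" for m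
    using mono_on_dyadics r_le[OF t] by blast+
  then show ?thesis
    using LIMSEQ_le[OF lim_of[OF P_cont s] lim_of[OF P_cont t]]
      LIMSEQ_le[OF lim_of[OF Q_cont s] lim_of[OF Q_cont t]] by blast
qed

end

section \<open>The cell of a digit sequence\<close>

definition digit_changes :: "(nat \<Rightarrow> int) \<Rightarrow> nat \<Rightarrow> real" where
  "digit_changes a m = (\<Sum>i=1..m. real_of_int \<bar>a i - a (i + 1)\<bar>)"

lemma digit_changes_Suc_shift:
  "digit_changes a (Suc m) = \<bar>a 1 - a 2\<bar> + digit_changes (\<lambda>i. a (Suc i)) m"
proof -
  have "digit_changes a (Suc m)
      = \<bar>a 1 - a 2\<bar> + (\<Sum>i=Suc 1..Suc m. real_of_int \<bar>a i - a (i + 1)\<bar>)"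
    unfolding digit_changes_def by (subst sum.atLeast_Suc_atMost) (simp_all add: numeral_2_eq_2)
  then show ?thesis
    unfolding digit_changes_def sum.shift_bounds_cl_Suc_ivl by simp
qed

lemma binary_digits_of_in_unit:
  assumes "binary_digits_of a s"
  shows "s \<in> {0..1}"
proof -
  have sums: "(\<lambda>i. real_of_int (a (Suc i)) / 2 ^ Suc i) sums s"
    and dig: "a (Suc i) \<in> {0, 1}" for i
    using assms unfolding binary_digits_of_def by auto
  have "0 \<le> real_of_int (a (Suc i)) / 2 ^ Suc i" for i using dig[of i] by auto
  then have "0 \<le> s" using sums sums_le[OF _ sums_zero sums] by blast
  moreover have "real_of_int (a (Suc i)) / 2 ^ Suc i \<le> (1 / 2) ^ Suc i" for i
    using dig[of i] by (auto simp: field_simps)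
  then have "s \<le> 1" using sums_le[OF _ sums power_half_series] by blast
  ultimately show ?thesis by simp
qed

lemma binary_digits_of_shift:
  assumes "binary_digits_of a s"
  shows "binary_digits_of (\<lambda>i. a (Suc i)) (2 * s - a 1)"
proof -
  have "(\<lambda>i. real_of_int (a (Suc (Suc i))) / 2 ^ Suc (Suc i)) sums (s - a 1 / 2)"
    using assms sums_Suc_iff[of "\<lambda>i. real_of_int (a (Suc i)) / 2 ^ Suc i" "s - a 1 / 2"]
    unfolding binary_digits_of_def by simp
  from sums_mult[OF this, of 2]
  have "(\<lambda>i. real_of_int (a (Suc (Suc i))) / 2 ^ Suc i) sums (2 * s - a 1)"
    by (simp add: right_diff_distrib)
  then show ?thesis using assms unfolding binary_digits_of_def by auto
qed

context gasket_coordinates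
begin

text \<open>
  The coordinate on the right-hand side is the one that the first digit multiplies by exactly
  \<open>3/5\<close>. Removing the first digit replaces \<open>s\<close> by \<open>2s - a 1\<close>. The count of digit changes
  includes the one between the digits \<open>m\<close> and \<open>m + 1\<close>, although the cell depends only on the
  first \<open>m\<close> digits; this makes the induction uniform and costs at most a factor 2.
\<close>
lemma digit_cell_increment:
  assumes "binary_digits_of a s"
  shows "\<exists>k<2 ^ m. real k / 2 ^ m \<le> s \<and> s \<le> (real k + 1) / 2 ^ m \<and>
    (3 / 5) ^ m * (1 / 2) powr digit_changes a m \<le> (if a 1 = 0 then dQ m k else dP m k)"
  using assms
proof (induction m arbitrary: a s)
  case 0
  then show ?case
    using binary_digits_of_in_unit[of a s]
    by (auto simp: cell_increment_def P_0 P_1 Q_0 Q_1 digit_changes_def)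
next
  case (Suc m)
  let ?b = "\<lambda>i. a (Suc i)"
  obtain k where k: "k < 2 ^ m" and lo: "real k / 2 ^ m \<le> 2 * s - a 1"
    and hi: "2 * s - a 1 \<le> (real k + 1) / 2 ^ m"
    and inc: "(3 / 5) ^ m * (1 / 2) powr digit_changes ?b m \<le> (if a 2 = 0 then dQ m k else dP m k)"
    using Suc.IH[OF binary_digits_of_shift[OF Suc.prems]] by (auto simp: numeral_2_eq_2)
  have dig: "a 1 \<in> {0, 1}" "a 2 \<in> {0, 1}" using Suc.prems unfolding binary_digits_of_def by auto
  note cone = increment_in_cone[OF k]
  have "(3 / 5) ^ Suc m * (1 / 2) powr digit_changes a (Suc m)
      = 3 / 5 * ((1 / 2) powr \<bar>a 1 - a 2\<bar> * ((3 / 5) ^ m * (1 / 2) powr digit_changes ?b m))"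
    unfolding digit_changes_Suc_shift powr_add by simp
  also have "\<dots> \<le> 3 / 5 * ((1 / 2) powr \<bar>a 1 - a 2\<bar> * (if a 2 = 0 then dQ m k else dP m k))"
    using inc by (intro mult_left_mono) auto
  \<comment> \<open>a change of digit, the only source of loss, passes from one coordinate to the other\<close>
  also have "\<dots> \<le> 3 / 5 * (if a 1 = 0 then dQ m k else dP m k)"
    using dig cone by auto
  finally have bound: "(3 / 5) ^ Suc m * (1 / 2) powr digit_changes a (Suc m)
      \<le> 3 / 5 * (if a 1 = 0 then dQ m k else dP m k)" .
  show ?case
  proof (cases "a 1 = 0")
    case True
    then show ?thesis
      using k lo hi bound by (intro exI[of _ k]) (auto simp: increment_left[OF k] field_simps)
  next
    case False
    with dig have "a 1 = 1" by simp
    have "real (2 ^ m + k) / 2 ^ Suc m \<le> s" "s \<le> (real (2 ^ m + k) + 1) / 2 ^ Suc m"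
      using lo hi \<open>a 1 = 1\<close> by (simp_all add: field_simps)
    then show ?thesis
      using k bound \<open>a 1 = 1\<close>
      by (intro exI[of _ "2 ^ m + k"]) (simp add: increment_right[OF k])
  qed
qed

text \<open>
  A neighbour of the cell of \<open>s\<close> is used because the cell itself may stick out beyond \<open>s\<close> on
  the side away from \<open>t\<close>, whereas its neighbour towards \<open>t\<close> lies entirely between \<open>s\<close> and
  \<open>t\<close> as soon as these are two cell lengths apart.
\<close>
lemma coordinate_separation:
  assumes a: "binary_digits_of a s" and t: "t \<in> {0..1}" and far: "2 / 2 ^ m \<le> \<bar>t - s\<bar>"
  shows "(3 / 5) ^ m * (1 / 2) powr digit_changes a m / 2 \<le> max \<bar>P t - P s\<bar> \<bar>Q t - Q s\<bar>"
proof -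
  have s: "s \<in> {0..1}" using binary_digits_of_in_unit[OF a] .
  obtain k where k: "k < 2 ^ m" and lo: "real k / 2 ^ m \<le> s" and hi: "s \<le> (real k + 1) / 2 ^ m"
    and inc: "(3 / 5) ^ m * (1 / 2) powr digit_changes a m \<le> (if a 1 = 0 then dQ m k else dP m k)"
    using digit_cell_increment[OF a, of m] by blast
  have "(3 / 5) ^ m * (1 / 2) powr digit_changes a m \<le> max (dP m k) (dQ m k)"
    using inc by (auto split: if_splits)
  moreover have "dP m k / 2 \<le> \<bar>P t - P s\<bar> \<and> dQ m k / 2 \<le> \<bar>Q t - Q s\<bar>"
  proof (cases "s < t")
    case True
    have next_le: "(real k + 2) / 2 ^ m \<le> t"
      using True far lo by (simp add: field_simps abs_if split: if_splits)
    have "real k + 2 \<le> t * 2 ^ m" using next_le by (simp add: field_simps)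
    also have "\<dots> \<le> 2 ^ m" using t by simp
    finally have "real (Suc (Suc k)) \<le> real (2 ^ m)" by simp
    then have lt: "Suc k < 2 ^ m" by (simp only: of_nat_le_iff Suc_le_eq)
    have "P s \<le> P ((real k + 1) / 2 ^ m)" "Q s \<le> Q ((real k + 1) / 2 ^ m)"
      using mono_coordinates[of s "(real k + 1) / 2 ^ m"] s hi dyadic_in_unit[of "Suc k" m] lt
      by (auto simp: add.commute)
    moreover have "P ((real k + 2) / 2 ^ m) \<le> P t" "Q ((real k + 2) / 2 ^ m) \<le> Q t"
      using mono_coordinates[of "(real k + 2) / 2 ^ m" t] t next_le by auto
    ultimately show ?thesis
      using neighbouring_increments_comparable[OF lt]
      by (auto simp: cell_increment_def add_ac)
  next
    case False
    have prev_ge: "t \<le> (real k - 1) / 2 ^ m"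
      using False far hi by (simp add: field_simps abs_if split: if_splits)
    have "k \<noteq> 0"
    proof
      assume "k = 0"
      then have "t \<le> - (1 / 2 ^ m)" using prev_ge by simp
      moreover have "0 < 1 / (2::real) ^ m" by simp
      ultimately have "t < 0" by linarith
      then show False using t by simp
    qed
    then obtain j where j: "k = Suc j" by (cases k) auto
    have lt: "Suc j < 2 ^ m" using j k by simp
    have "P (real k / 2 ^ m) \<le> P s" "Q (real k / 2 ^ m) \<le> Q s"
      using mono_coordinates[of "real k / 2 ^ m" s] s lo by auto
    moreover have "P t \<le> P (real j / 2 ^ m)" "Q t \<le> Q (real j / 2 ^ m)"
      using mono_coordinates[of t "real j / 2 ^ m"] t prev_ge dyadic_in_unit[of j m] lt j by auto
    ultimately show ?thesis
      using neighbouring_increments_comparable[OF lt] unfolding j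
      by (auto simp: cell_increment_def add_ac)
  qed
  ultimately show ?thesis by linarith
qed

end

section \<open>Passage to an arbitrary norm and to the limit\<close>

text \<open>
  One half of the equivalence of norms in finite dimension: \<open>N\<close> is Lipschitz for the Euclidean
  norm, so it attains a minimum on the unit sphere, and this minimum is positive.
\<close>
lemma is_norm_ge_norm:
  fixes N :: "'a::euclidean_space \<Rightarrow> real"
  assumes N: "is_norm N"
  obtains c where "c > 0" "\<And>x. c * norm x \<le> N x"
proof -
  have nonneg: "0 \<le> N x" and zero: "N x = 0 \<longleftrightarrow> x = 0" and tri: "N (x + y) \<le> N x + N y"
    and scale: "N (c *\<^sub>R x) = \<bar>c\<bar> * N x" for x y c
    using N unfolding is_norm_def by blast+
  define K where "K = (\<Sum>b\<in>Basis. N (b::'a))"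
  have upper: "N x \<le> K * norm x" for x
  proof -
    have "N x = N (\<Sum>b\<in>Basis. (x \<bullet> b) *\<^sub>R b)" by (simp add: euclidean_representation)
    also have "\<dots> \<le> (\<Sum>b\<in>Basis. N ((x \<bullet> b) *\<^sub>R b))"
    proof (induction rule: finite_induct[OF finite_Basis])
      case (2 b F)
      then show ?case using tri[of "(x \<bullet> b) *\<^sub>R b" "\<Sum>b\<in>F. (x \<bullet> b) *\<^sub>R b"] by simp
    qed (simp add: zero[THEN iffD2])
    also have "\<dots> \<le> (\<Sum>b\<in>Basis. N b * norm x)"
      by (intro sum_mono) (auto simp: scale nonneg Basis_le_norm mult.commute intro: mult_left_mono)
    finally show ?thesis by (simp add: K_def sum_distrib_right)
  qed
  have minus: "N (x - y) = N (y - x)" for x y using scale[of "-1" "x - y"] by simp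
  have "dist (N x) (N y) \<le> K * dist x y" for x y
    using tri[of "x - y" y] tri[of "y - x" x] minus[of x y] upper[of "x - y"]
    by (simp add: dist_real_def dist_norm)
  moreover have "0 \<le> K" unfolding K_def by (intro sum_nonneg nonneg)
  ultimately have "K-lipschitz_on (sphere 0 1) N" by (intro lipschitz_onI)
  then have "continuous_on (sphere 0 1) N" by (rule lipschitz_on_continuous_on)
  moreover have "(sphere 0 1 :: 'a set) \<noteq> {}" by simp
  ultimately obtain w where w: "norm w = 1" and min: "\<And>x. norm x = 1 \<Longrightarrow> N w \<le> N x"
    using continuous_attains_inf[OF compact_sphere, of 0 1 N] by auto
  show ?thesis
  proof
    show "N w > 0" using nonneg[of w] zero[of w] w by force
    show "N w * norm x \<le> N x" for x
    proof (cases "x = 0")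
      case True
      then show ?thesis using nonneg[of x] by simp
    next
      case False
      have "N w \<le> N ((1 / norm x) *\<^sub>R x)" using False by (intro min) simp
      then show ?thesis using False by (simp add: scale field_simps)
    qed
  qed
qed

text \<open>
  If \<open>d\<close> lies strictly between \<open>d_sup a\<close> and \<open>log 2 (6/5)\<close>, then eventually there are at most
  \<open>d m\<close> changes among the first \<open>m\<close> digits, and the quantity dominates the \<open>m\<close>-th power of
  \<open>(6/5) 2^(-d) > 1\<close>.
\<close>
lemma growth_of_few_digit_changes:
  assumes "d_sup a < ereal (1 - ln (3/5) / ln (1/2))"
  shows "filterlim (\<lambda>m. (6 / 5) ^ m * (1 / 2) powr digit_changes a m) at_top sequentially"
proof -
  obtain d where d: "d_sup a < ereal d" "ereal d < ereal (1 - ln (3/5) / ln (1/2))"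
    using ereal_dense2[OF assms] by blast
  have "1 - ln (3/5) / ln (1/2) = ln (6/5) / ln (2::real)"
    by (simp add: ln_div field_simps) (simp add: ln_mult[of 2 3, simplified])
  with d(2) have "d * ln 2 < ln (6/5)" by (simp add: field_simps)
  define q where "q = 6 / 5 * (1 / 2) powr d"
  have "q = exp (ln (6/5) - d * ln 2)"
    by (simp add: q_def powr_def exp_diff ln_div exp_minus exp_add field_simps)
  then have q: "q > 1" using \<open>d * ln 2 < ln (6/5)\<close> by simp
  have "eventually (\<lambda>n. ereal (1 / real n * digit_changes a n) < ereal d) sequentially"
    using d(1) unfolding d_sup_def digit_changes_def by (rule Limsup_lessD)
  then have "eventually (\<lambda>m. q ^ m \<le> (6 / 5) ^ m * (1 / 2) powr digit_changes a m) sequentially"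
    using eventually_gt_at_top[of 0]
  proof eventually_elim
    case (elim m)
    then have "digit_changes a m \<le> d * real m" by (simp add: field_simps)
    then have "(1 / 2) powr (d * real m) \<le> (1 / 2::real) powr digit_changes a m"
      by (intro powr_mono') auto
    moreover have "q ^ m = (6 / 5) ^ m * (1 / 2) powr (d * real m)"
      unfolding q_def power_mult_distrib by (simp add: powr_realpow[symmetric] powr_powr)
    ultimately show ?case by simp
  qed
  moreover have "filterlim (\<lambda>m. q ^ m) at_top sequentially"
    unfolding filterlim_at_top_dense eventually_sequentially
  proof
    fix Z
    obtain n where "Z < q ^ n" using real_arch_pow[OF q] by blast
    then have "\<forall>m\<ge>n. Z < q ^ m"
      using q power_increasing[of n _ q] by (meson less_eq_real_def less_le_trans)
    then show "\<exists>n. \<forall>m\<ge>n. Z < q ^ m" by blast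
  qed
  ultimately show ?thesis by (blast intro: filterlim_at_top_mono)
qed

lemma dyadic_scale:
  fixes d :: real
  assumes "0 < d" "d < 2 / 2 ^ M"
  obtains m where "m \<ge> M" "2 / 2 ^ m \<le> d" "d < 4 / 2 ^ m"
proof -
  have "\<exists>m. 2 / 2 ^ m \<le> d"
  proof -
    obtain m where "(1 / 2) ^ m < d / 2" using real_arch_pow_inv[of "d / 2" "1 / 2"] assms by auto
    then show ?thesis by (intro exI[of _ m]) (simp add: field_simps)
  qed
  then obtain m where m: "2 / 2 ^ m \<le> d" and least: "\<And>j. j < m \<Longrightarrow> \<not> 2 / 2 ^ j \<le> d"
    using exists_least_iff[of "\<lambda>m. 2 / 2 ^ m \<le> d"] by blast
  have "2 / 2 ^ m < (2::real) / 2 ^ M" using m assms(2) by simp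
  then have "M < m" by (simp add: field_simps)
  then obtain j where j: "m = Suc j" by (cases m) auto
  show ?thesis
    by (rule that[of m]) (use \<open>M < m\<close> m least[of j] j in auto)
qed

theorem corollary19:
  fixes u :: "real \<Rightarrow> real^3" and s :: real and a :: "nat \<Rightarrow> int"
  assumes "gasket_curve u"
    and "s \<in> {0..1}"
    and "lower_binary_expansion a s \<or> upper_binary_expansion a s"
    and "d_sup a < ereal (1 - ln (3/5) / ln (1/2))"
  shows "infinite_derivative u s"
  unfolding infinite_derivative_def
proof (intro allI impI)
  fix N :: "real^3 \<Rightarrow> real"
  assume "is_norm N"
  then obtain c where c: "c > 0" and N: "\<And>x. c * norm x \<le> N x" by (rule is_norm_ge_norm) blast
  interpret gasket_coordinates "\<lambda>x. u x $ 2" "\<lambda>x. 1 - u x $ 1"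
    using assms(1) by (rule gasket_coordinates_of_curve)
  have a: "binary_digits_of a s"
    using assms(3) unfolding lower_binary_expansion_def upper_binary_expansion_def by blast
  let ?g = "\<lambda>m. (6 / 5) ^ m * (1 / 2) powr digit_changes a m"
  show "filterlim (\<lambda>t. N (u t - u s) / \<bar>t - s\<bar>) at_top (at s within {0..1})"
    unfolding filterlim_at_top
  proof
    fix Z :: real
    obtain M where M: "\<And>m. m \<ge> M \<Longrightarrow> 8 * Z / c \<le> ?g m"
      using growth_of_few_digit_changes[OF assms(4)]
      unfolding filterlim_at_top eventually_sequentially by blast
    have "Z \<le> N (u t - u s) / \<bar>t - s\<bar>"
      if t: "t \<in> {0..1}" "t \<noteq> s" and near: "dist t s < 2 / 2 ^ M" for t
    proof -
      obtain m where m: "m \<ge> M" "2 / 2 ^ m \<le> \<bar>t - s\<bar>" "\<bar>t - s\<bar> < 4 / 2 ^ m"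
        using dyadic_scale[of "\<bar>t - s\<bar>" M] t near by (auto simp: dist_real_def)
      have "Z * \<bar>t - s\<bar> \<le> c * ?g m / 8 * \<bar>t - s\<bar>"
        using M[OF m(1)] c by (intro mult_right_mono) (auto simp: field_simps)
      also have "\<dots> \<le> c * ?g m / 8 * (4 / 2 ^ m)"
        using m(3) c by (intro mult_left_mono) auto
      also have "\<dots> = c * ((3 / 5) ^ m * (1 / 2) powr digit_changes a m / 2)"
      proof -
        have "(6 / 5 :: real) ^ m = (3 / 5) ^ m * 2 ^ m"
          unfolding power_mult_distrib[symmetric] by simp
        then show ?thesis by simp
      qed
      also have "\<dots> \<le> c * norm (u t - u s)"
      proof -
        have "(3 / 5) ^ m * (1 / 2) powr digit_changes a m / 2
            \<le> max \<bar>u t $ 2 - u s $ 2\<bar> \<bar>(1 - u t $ 1) - (1 - u s $ 1)\<bar>"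
          by (rule coordinate_separation[OF a t(1) m(2)])
        also have "\<dots> \<le> norm (u t - u s)"
          using component_le_norm_cart[of "u t - u s" 1] component_le_norm_cart[of "u t - u s" 2]
          by auto
        finally show ?thesis using c by simp
      qed
      also have "\<dots> \<le> N (u t - u s)" by (rule N)
      finally show ?thesis using t by (simp add: field_simps)
    qed
    then show "\<forall>\<^sub>F t in at s within {0..1}. Z \<le> N (u t - u s) / \<bar>t - s\<bar>"
      unfolding eventually_at by (intro exI[of _ "2 / 2 ^ M"]) auto
  qed
qed

end
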